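(* Let $X$ be a Tychonoff space and let $I$ be an ideal in $C(X)$. The space $C_{u^I}(X)$ is metrizable; indeed the function $d:C(X)\times C(X)\to[0,\infty)$ given by $$d(f,g)=\begin{cases}1, & \text{if } f-g\notin I,\\ \min\{\sup\{|f(x)-g(x)|:x\in X\setminus\bigcap Z[I]\},\,1\}, & \text{if } f-g\in I,\end{cases}$$ is a metric on $C(X)$ which induces the $u^I$-topology on $C(X)$.
   Context: $C(X)$ is the ring of all real-valued continuous functions on $X$; ideals may be improper. $Z(g)=\{x\in X:g(x)=0\}$ and $\bigcap Z[I]=\bigcap_{g\in I}Z(g)$. The $u^I$-topology on $C(X)$ has as base the sets $B_u(f,I,\epsilon)=\{g\in C(X):\sup_{x\in X}|f(x)-g(x)|<\epsilon,\ f-g\in I\}$, $f\in C(X)$, $\epsilon>0$; $C_{u^I}(X)$ is $C(X)$ with this topology. The supremum is taken in $[0,\infty]$, with the supremum of the empty set equal to $0$. *)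

theory Defs
  imports "HOL-Analysis.Analysis" "HOL-Algebra.Ideal"
begin

text \<open>
  The ring C(X). Functions live on the whole type, so the carrier takes only those that are
  \<open>undefined\<close> off \<open>topspace X\<close>; functions that agree on the space are then equal, and
  pointwise operations are restricted accordingly.
\<close>

definition cont_ring :: "'a topology \<Rightarrow> ('a \<Rightarrow> real) ring" where
  "cont_ring X =
    \<lparr>carrier = {f. continuous_map X euclideanreal f} \<inter> extensional (topspace X),
     mult = (\<lambda>f g. \<lambda>x\<in>topspace X. f x * g x),
     one = (\<lambda>x\<in>topspace X. 1),
     zero = (\<lambda>x\<in>topspace X. 0),
     add = (\<lambda>f g. \<lambda>x\<in>topspace X. f x + g x)\<rparr>"

definition zero_set :: "'a topology \<Rightarrow> ('a \<Rightarrow> real) \<Rightarrow> 'a set" where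
  "zero_set X g = {x \<in> topspace X. g x = 0}"

text \<open>
  The supremum is taken in \<^typ>\<open>ennreal\<close>, i.e. in \<open>[0, \<infinity>]\<close>, whose least element 0 is the
  supremum of the empty set. The difference \<open>f - g\<close> is written pointwise; on the carrier it is
  the ring's \<open>f \<ominus> g\<close> (see \<open>minus_cont_ring\<close>). The ring's version is unspecified for
  discontinuous arguments, while \<^const>\<open>Metric_space\<close> asks for symmetry off the carrier as well.
\<close>

definition uI_ball ::
  "'a topology \<Rightarrow> ('a \<Rightarrow> real) set \<Rightarrow> ('a \<Rightarrow> real) \<Rightarrow> real \<Rightarrow> ('a \<Rightarrow> real) set" where
  "uI_ball X I f \<epsilon> =
    {g \<in> carrier (cont_ring X).
       (SUP x\<in>topspace X. ennreal \<bar>f x - g x\<bar>) < ennreal \<epsilon> \<and> (\<lambda>x\<in>topspace X. f x - g x) \<in> I}"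

definition uI_topology :: "'a topology \<Rightarrow> ('a \<Rightarrow> real) set \<Rightarrow> ('a \<Rightarrow> real) topology" where
  "uI_topology X I =
    topology (arbitrary union_of
      (\<lambda>U. \<exists>f \<in> carrier (cont_ring X). \<exists>\<epsilon>>0. U = uI_ball X I f \<epsilon>))"

definition uI_dist ::
  "'a topology \<Rightarrow> ('a \<Rightarrow> real) set \<Rightarrow> ('a \<Rightarrow> real) \<Rightarrow> ('a \<Rightarrow> real) \<Rightarrow> real" where
  "uI_dist X I f g =
    (if (\<lambda>x\<in>topspace X. f x - g x) \<notin> I then 1
     else enn2real (min (SUP x\<in>topspace X - (\<Inter>h\<in>I. zero_set X h). ennreal \<bar>f x - g x\<bar>) 1))"

lemma carrier_cont_ring:
  "f \<in> carrier (cont_ring X) \<longleftrightarrow>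
     continuous_map X euclideanreal f \<and> f \<in> extensional (topspace X)"
  by (simp add: cont_ring_def)

lemma continuous_map_restrict_topspace:
  "continuous_map X Y f \<Longrightarrow> continuous_map X Y (\<lambda>x\<in>topspace X. f x)"
  by (rule continuous_map_eq) auto

lemma cring_cont_ring: "cring (cont_ring X)"
proof (rule cringI)
  show "abelian_group (cont_ring X)"
  proof (rule abelian_groupI)
    fix f assume f: "f \<in> carrier (cont_ring X)"
    have "(\<lambda>x\<in>topspace X. - f x) \<in> carrier (cont_ring X)"
      using f by (auto simp: carrier_cont_ring
          intro!: continuous_map_restrict_topspace continuous_map_minus)
    moreover have "(\<lambda>x\<in>topspace X. - f x) \<oplus>\<^bsub>cont_ring X\<^esub> f = \<zero>\<^bsub>cont_ring X\<^esub>"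
      by (auto simp: cont_ring_def restrict_def)
    ultimately show "\<exists>g\<in>carrier (cont_ring X). g \<oplus>\<^bsub>cont_ring X\<^esub> f = \<zero>\<^bsub>cont_ring X\<^esub>"
      by blast
  qed (auto simp: cont_ring_def restrict_def extensional_def fun_eq_iff
      intro!: continuous_map_restrict_topspace[unfolded restrict_def] continuous_map_add)
  show "Group.comm_monoid (cont_ring X)"
    by (rule comm_monoidI)
      (auto simp: cont_ring_def restrict_def extensional_def fun_eq_iff
        intro!: continuous_map_restrict_topspace[unfolded restrict_def] continuous_map_real_mult)
qed (auto simp: cont_ring_def restrict_def fun_eq_iff algebra_simps)

lemma minus_cont_ring:
  assumes "f \<in> carrier (cont_ring X)" "g \<in> carrier (cont_ring X)"
  shows "f \<ominus>\<^bsub>cont_ring X\<^esub> g = (\<lambda>x\<in>topspace X. f x - g x)"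
proof -
  interpret cring "cont_ring X" by (rule cring_cont_ring)
  have "(\<lambda>x\<in>topspace X. - g x) \<in> carrier (cont_ring X)"
    using assms(2) by (auto simp: carrier_cont_ring
        intro!: continuous_map_restrict_topspace continuous_map_minus)
  moreover have "(\<lambda>x\<in>topspace X. - g x) \<oplus>\<^bsub>cont_ring X\<^esub> g = \<zero>\<^bsub>cont_ring X\<^esub>"
    by (auto simp: cont_ring_def restrict_def)
  ultimately have "\<ominus>\<^bsub>cont_ring X\<^esub> g = (\<lambda>x\<in>topspace X. - g x)"
    using assms(2) minus_equality by blast
  then show ?thesis
    by (auto simp: a_minus_def) (auto simp: cont_ring_def restrict_def)
qed

lemma uI_ball_subset:
  assumes I: "ideal I (cont_ring X)" and f: "f \<in> carrier (cont_ring X)"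
    and g: "g \<in> uI_ball X I f \<epsilon>"
  obtains \<delta> where "\<delta> > 0" "uI_ball X I g \<delta> \<subseteq> uI_ball X I f \<epsilon>"
proof -
  interpret ideal I "cont_ring X" by (rule I)
  define s where "s = (SUP x\<in>topspace X. ennreal \<bar>f x - g x\<bar>)"
  have s: "s < ennreal \<epsilon>" and fg: "(\<lambda>x\<in>topspace X. f x - g x) \<in> I" and gC: "g \<in> carrier (cont_ring X)"
    using g by (auto simp: uI_ball_def s_def)
  obtain r where r: "r \<ge> 0" "s = ennreal r"
    using s by (metis ennreal_cases infinity_ennreal_def not_less_iff_gr_or_eq
        order_less_le_trans top_greatest)
  have re: "r < \<epsilon>"
    using s r by (metis ennreal_leI leD leI)
  show thesis
  proof
    show "\<epsilon> - r > 0" using re by simp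
    show "uI_ball X I g (\<epsilon> - r) \<subseteq> uI_ball X I f \<epsilon>"
    proof
      fix h assume h: "h \<in> uI_ball X I g (\<epsilon> - r)"
      let ?t = "SUP x\<in>topspace X. ennreal \<bar>g x - h x\<bar>"
      have hC: "h \<in> carrier (cont_ring X)" and gh: "(\<lambda>x\<in>topspace X. g x - h x) \<in> I"
        and t: "?t < ennreal (\<epsilon> - r)"
        using h by (auto simp: uI_ball_def)
      have "(SUP x\<in>topspace X. ennreal \<bar>f x - h x\<bar>) \<le> s + ?t"
      proof (rule SUP_least)
        fix x assume x: "x \<in> topspace X"
        have "ennreal \<bar>f x - h x\<bar> \<le> ennreal (\<bar>f x - g x\<bar> + \<bar>g x - h x\<bar>)"
          by (rule ennreal_leI) linarith
        also have "\<dots> = ennreal \<bar>f x - g x\<bar> + ennreal \<bar>g x - h x\<bar>"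
          by simp
        also have "\<dots> \<le> s + ?t"
          unfolding s_def by (intro add_mono SUP_upper x)
        finally show "ennreal \<bar>f x - h x\<bar> \<le> s + ?t" .
      qed
      also have "\<dots> < ennreal r + ennreal (\<epsilon> - r)"
        using t by (simp add: r(2) ennreal_add_left_cancel_less)
      also have "\<dots> = ennreal \<epsilon>"
        using r(1) re by (simp flip: ennreal_plus)
      finally have "(SUP x\<in>topspace X. ennreal \<bar>f x - h x\<bar>) < ennreal \<epsilon>" .
      moreover have "(\<lambda>x\<in>topspace X. f x - h x) = (\<lambda>x\<in>topspace X. f x - g x) \<oplus>\<^bsub>cont_ring X\<^esub> (\<lambda>x\<in>topspace X. g x - h x)"
        by (auto simp: cont_ring_def restrict_def)
      ultimately show "h \<in> uI_ball X I f \<epsilon>"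
        using hC additive_subgroup.a_closed[OF is_additive_subgroup fg gh] by (simp add: uI_ball_def)
    qed
  qed
qed

lemma openin_uI_topology:
  assumes I: "ideal I (cont_ring X)"
  shows "openin (uI_topology X I) =
    arbitrary union_of (\<lambda>U. \<exists>f \<in> carrier (cont_ring X). \<exists>\<epsilon>>0. U = uI_ball X I f \<epsilon>)"
    (is "_ = arbitrary union_of ?P")
proof -
  interpret ideal I "cont_ring X" by (rule I)
  have "istopology (arbitrary union_of ?P)"
    unfolding istopology_base_eq
  proof (intro allI impI)
    fix S T assume "?P S \<and> ?P T"
    then obtain f g \<epsilon> \<delta> where f: "f \<in> carrier (cont_ring X)" "S = uI_ball X I f \<epsilon>"
      and g: "g \<in> carrier (cont_ring X)" "T = uI_ball X I g \<delta>" by blast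
    have "\<exists>U. ?P U \<and> h \<in> U \<and> U \<subseteq> S \<inter> T" if h: "h \<in> S \<inter> T" for h
    proof -
      obtain a where a: "a > 0" "uI_ball X I h a \<subseteq> S"
        using uI_ball_subset[OF I f(1)] h f(2) by blast
      obtain b where b: "b > 0" "uI_ball X I h b \<subseteq> T"
        using uI_ball_subset[OF I g(1)] h g(2) by blast
      have hC: "h \<in> carrier (cont_ring X)"
        using h f(2) by (simp add: uI_ball_def)
      have "uI_ball X I h (min a b) \<subseteq> uI_ball X I h a \<inter> uI_ball X I h b"
        using order_less_le_trans[OF _ ennreal_leI[OF min.cobounded1]]
          order_less_le_trans[OF _ ennreal_leI[OF min.cobounded2]]
        unfolding uI_ball_def by blast
      moreover have "h \<in> uI_ball X I h (min a b)"
      proof -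
        have "(SUP x\<in>topspace X. ennreal \<bar>h x - h x\<bar>) \<le> 0"
          by (rule SUP_least) simp
        moreover have "(\<lambda>x\<in>topspace X. h x - h x) = \<zero>\<^bsub>cont_ring X\<^esub>"
          by (simp add: cont_ring_def)
        ultimately show ?thesis
          using hC a(1) b(1) additive_subgroup.zero_closed[OF is_additive_subgroup]
          by (simp add: uI_ball_def)
      qed
      ultimately show ?thesis
        using a b hC
        by (intro exI[of _ "uI_ball X I h (min a b)"] conjI bexI[of _ h] exI[of _ "min a b"]) auto
    qed
    then show "(arbitrary union_of ?P) (S \<inter> T)"
      unfolding arbitrary_union_of_alt by blast
  qed
  then show ?thesis
    unfolding uI_topology_def by (rule topology_inverse')
qed

end

theory Submission
  imports Defs
begin

text \<open>
  If \<open>f - g \<in> I\<close> then \<open>f\<close> and \<open>g\<close> agree on \<open>\<Inter>Z[I]\<close>, so the supremum in \<open>d\<close> may be taken over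
  all of \<open>X\<close>. Truncating at 1 does not affect comparisons with radii at most 1, hence the
  \<open>d\<close>-balls of such radii are exactly the basic sets \<open>B\<^sub>u(f, I, \<epsilon>)\<close>. For the triangle
  inequality, pairs whose difference lies outside \<open>I\<close> have the maximal distance 1.
\<close>

abbreviation diff_on :: "'a topology \<Rightarrow> ('a \<Rightarrow> real) \<Rightarrow> ('a \<Rightarrow> real) \<Rightarrow> 'a \<Rightarrow> real" where
  "diff_on X f g \<equiv> (\<lambda>x\<in>topspace X. f x - g x)"

abbreviation sup_dist :: "'a topology \<Rightarrow> ('a \<Rightarrow> real) \<Rightarrow> ('a \<Rightarrow> real) \<Rightarrow> ennreal" where
  "sup_dist X f g \<equiv> (SUP x\<in>topspace X. ennreal \<bar>f x - g x\<bar>)"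

lemma sup_dist_commute: "sup_dist X f g = sup_dist X g f"
  by (simp add: abs_minus_commute)

lemma sup_dist_triangle: "sup_dist X f h \<le> sup_dist X f g + sup_dist X g h"
proof (rule SUP_least)
  fix x assume x: "x \<in> topspace X"
  have "ennreal \<bar>f x - h x\<bar> \<le> ennreal (\<bar>f x - g x\<bar> + \<bar>g x - h x\<bar>)"
    by (rule ennreal_leI) linarith
  also have "\<dots> = ennreal \<bar>f x - g x\<bar> + ennreal \<bar>g x - h x\<bar>"
    by simp
  also have "\<dots> \<le> sup_dist X f g + sup_dist X g h"
    by (intro add_mono SUP_upper x)
  finally show "ennreal \<bar>f x - h x\<bar> \<le> sup_dist X f g + sup_dist X g h" .
qed

lemma sup_dist_eq_0_iff: "sup_dist X f g = 0 \<longleftrightarrow> (\<forall>x\<in>topspace X. f x = g x)"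
proof -
  have "sup_dist X f g = 0 \<longleftrightarrow> (\<forall>x\<in>topspace X. ennreal \<bar>f x - g x\<bar> \<le> 0)"
    by (simp only: SUP_le_iff flip: le_zero_eq)
  then show ?thesis by simp
qed

text \<open>If both \<open>b\<close> and \<open>c\<close> are at most 1, truncation leaves the right
  side equal to \<open>b + c\<close>. Otherwise one truncated summand is already 1, which bounds
  \<open>min a 1\<close>.\<close>

lemma min_add_le_1:
  fixes a b c :: ennreal
  assumes "a \<le> b + c"
  shows "min a 1 \<le> min b 1 + min c 1"
proof (cases "b \<le> 1 \<and> c \<le> 1")
  case True
  then show ?thesis using assms by (simp add: min.coboundedI1 min_absorb1)
next
  case False
  then have "1 \<le> min b 1 + min c 1"
    by (auto simp: min_def intro: add_increasing add_increasing2)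
  then show ?thesis by (simp add: min.coboundedI2)
qed

text \<open>\<open>I\<close> is closed under negation. The functions \<open>f\<close> and
  \<open>g\<close> are arbitrary because \<open>Metric_space\<close> demands symmetry off the
  carrier too; only their difference has to be continuous, and membership in \<open>I\<close>
  ensures that.\<close>

lemma diff_on_commute_mem:
  assumes "ideal I (cont_ring X)" "diff_on X f g \<in> I"
  shows "diff_on X g f \<in> I"
proof -
  interpret ideal I "cont_ring X" by (rule assms(1))
  have "\<zero>\<^bsub>cont_ring X\<^esub> \<ominus>\<^bsub>cont_ring X\<^esub> diff_on X f g \<in> I"
    using assms(2) by (simp add: a_minus_def)
  moreover have "\<zero>\<^bsub>cont_ring X\<^esub> \<ominus>\<^bsub>cont_ring X\<^esub> diff_on X f g = diff_on X g f"
    using zero_closed a_Hcarr[OF assms(2)]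
    by (subst minus_cont_ring) (auto simp: cont_ring_def)
  ultimately show ?thesis by simp
qed

lemma diff_on_trans_mem:
  assumes "ideal I (cont_ring X)" "diff_on X f g \<in> I" "diff_on X g h \<in> I"
  shows "diff_on X f h \<in> I"
proof -
  interpret ideal I "cont_ring X" by (rule assms(1))
  have "diff_on X f h = diff_on X f g \<oplus>\<^bsub>cont_ring X\<^esub> diff_on X g h"
    by (auto simp: cont_ring_def restrict_def)
  then show ?thesis
    using additive_subgroup.a_closed[OF is_additive_subgroup] assms(2,3) by simp
qed

lemma diff_on_self_mem:
  assumes "ideal I (cont_ring X)"
  shows "diff_on X f f \<in> I"
proof -
  interpret ideal I "cont_ring X" by (rule assms)
  show ?thesis
    using additive_subgroup.zero_closed[OF is_additive_subgroup] by (simp add: cont_ring_def)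
qed

text \<open>The intersection of zero sets ranges over all of \<open>I\<close>, so it lies inside the
  zero set of \<open>diff_on X f g\<close> itself: the points left out of the supremum would
  contribute only 0. If no points remain, both suprema are 0.\<close>

lemma uI_dist_altdef:
  "uI_dist X I f g =
    (if diff_on X f g \<in> I then enn2real (min (sup_dist X f g) 1) else 1)"
proof (cases "diff_on X f g \<in> I")
  case True
  let ?Z = "\<Inter>h\<in>I. zero_set X h"
  have "(SUP x\<in>topspace X - ?Z. ennreal \<bar>f x - g x\<bar>) = sup_dist X f g"
  proof (rule antisym)
    show "sup_dist X f g \<le> (SUP x\<in>topspace X - ?Z. ennreal \<bar>f x - g x\<bar>)"
    proof (rule SUP_least)
      fix x assume x: "x \<in> topspace X"
      show "ennreal \<bar>f x - g x\<bar> \<le> (SUP x\<in>topspace X - ?Z. ennreal \<bar>f x - g x\<bar>)"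
      proof (cases "x \<in> ?Z")
        case True
        with \<open>diff_on X f g \<in> I\<close> have "x \<in> zero_set X (diff_on X f g)" by blast
        with x have "\<bar>f x - g x\<bar> = 0" by (simp add: zero_set_def)
        then show ?thesis by (simp only: ennreal_0 zero_le)
      next
        case False
        with x show ?thesis by (intro SUP_upper) auto
      qed
    qed
  qed (rule SUP_subset_mono, auto)
  with True show ?thesis by (simp add: uI_dist_def)
qed (simp add: uI_dist_def)

text \<open>\<open>enn2real\<close> sends \<infinity> to 0, so comparing values, adding them or
  detecting 0 through it calls for finite arguments. Truncation at 1 supplies this
  finiteness.\<close>

lemma min_1_less_top: "min a (1::ennreal) < top_class.top"
  by (simp add: min_less_iff_disj)

lemma uI_dist_nonneg: "0 \<le> uI_dist X I f g"
  by (simp add: uI_dist_altdef)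

lemma uI_dist_le_1: "uI_dist X I f g \<le> 1"
  by (simp add: uI_dist_altdef enn2real_leI)

text \<open>The bound \<open>r \<le> 1\<close> acts twice: it rules out the value 1 taken when the
  difference is outside \<open>I\<close>, and it makes \<open>min a 1 < ennreal r\<close> equivalent
  to \<open>a < ennreal r\<close>.\<close>

lemma uI_dist_less_iff:
  assumes "0 < r" "r \<le> 1"
  shows "uI_dist X I f g < r \<longleftrightarrow> diff_on X f g \<in> I \<and> sup_dist X f g < ennreal r"
proof -
  have "enn2real (min a 1) < r \<longleftrightarrow> a < ennreal r" for a
  proof -
    have "enn2real (min a 1) < r \<longleftrightarrow> min a 1 < ennreal r"
      using assms(1) min_1_less_top[of a]
      by (metis enn2real_nonneg ennreal_enn2real ennreal_less_iff)
    also have "\<dots> \<longleftrightarrow> a < ennreal r"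
      using assms(2) by (auto simp: min_less_iff_disj not_less)
    finally show ?thesis .
  qed
  then show ?thesis using assms by (simp add: uI_dist_altdef)
qed

lemma uI_dist_triangle:
  assumes "ideal I (cont_ring X)"
  shows "uI_dist X I f h \<le> uI_dist X I f g + uI_dist X I g h"
proof (cases "diff_on X f g \<in> I \<and> diff_on X g h \<in> I")
  case True
  have "enn2real (min (sup_dist X f h) 1)
      \<le> enn2real (min (sup_dist X f g) 1 + min (sup_dist X g h) 1)"
    by (intro enn2real_mono min_add_le_1 sup_dist_triangle)
      (simp add: min_less_iff_disj)
  also have "\<dots> = enn2real (min (sup_dist X f g) 1) + enn2real (min (sup_dist X g h) 1)"
    by (intro enn2real_plus min_1_less_top)
  finally show ?thesis
    using True diff_on_trans_mem[OF assms, of f g h] by (simp add: uI_dist_altdef)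
next
  \<comment> \<open>One of the two distances on the right is 1, the largest possible value on the
    left.\<close>
  case False
  then have "uI_dist X I f g = 1 \<or> uI_dist X I g h = 1"
    by (auto simp: uI_dist_altdef)
  then show ?thesis
    using uI_dist_le_1[of X I f h] uI_dist_nonneg[of X I f g] uI_dist_nonneg[of X I g h]
    by linarith
qed

lemma uI_dist_eq_0_iff:
  assumes I: "ideal I (cont_ring X)"
    and f: "f \<in> carrier (cont_ring X)" and g: "g \<in> carrier (cont_ring X)"
  shows "uI_dist X I f g = 0 \<longleftrightarrow> f = g"
proof
  assume "uI_dist X I f g = 0"
  then have "min (sup_dist X f g) 1 = 0"
    using min_1_less_top[of "sup_dist X f g"]
    by (auto simp: uI_dist_altdef enn2real_eq_0_iff split: if_splits)
  then have "sup_dist X f g = 0"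
    by (metis min_def zero_neq_one)
  then have "\<And>x. x \<in> topspace X \<Longrightarrow> f x = g x"
    by (simp only: sup_dist_eq_0_iff)
  \<comment> \<open>Agreement on \<open>topspace X\<close> suffices, since members of the carrier
    are \<open>undefined\<close> elsewhere.\<close>
  then show "f = g"
    using f g by (auto simp: carrier_cont_ring intro: extensionalityI)
next
  assume "f = g"
  moreover have "sup_dist X g g = 0"
    by (subst sup_dist_eq_0_iff) simp
  ultimately show "uI_dist X I f g = 0"
    using diff_on_self_mem[OF I] by (simp add: uI_dist_altdef)
qed

lemma Metric_space_uI_dist:
  assumes "ideal I (cont_ring X)"
  shows "Metric_space (carrier (cont_ring X)) (uI_dist X I)"
proof
  show "uI_dist X I f g = uI_dist X I g f" for f g
    using diff_on_commute_mem[OF assms] sup_dist_commute[of f g X]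
    by (auto simp: uI_dist_altdef)
qed (use assms in \<open>auto simp: uI_dist_nonneg uI_dist_eq_0_iff intro: uI_dist_triangle\<close>)

lemma mball_uI_dist:
  assumes "ideal I (cont_ring X)" "f \<in> carrier (cont_ring X)" "0 < r" "r \<le> 1"
  shows "Metric_space.mball (carrier (cont_ring X)) (uI_dist X I) f r = uI_ball X I f r"
proof -
  interpret Metric_space "carrier (cont_ring X)" "uI_dist X I"
    by (rule Metric_space_uI_dist) fact
  show ?thesis
    using assms by (auto simp: set_eq_iff uI_dist_less_iff uI_ball_def)
qed

lemma uI_ball_mono: "r \<le> s \<Longrightarrow> uI_ball X I f r \<subseteq> uI_ball X I f s"
  unfolding uI_ball_def using order_less_le_trans[OF _ ennreal_leI] by blast

text \<open>Openness is tested pointwise on both sides: by a metric ball around each point, or by a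
  basic set containing it. Capping radii at 1 brings both tests into the range where
  \<open>mball_uI_dist\<close> identifies balls with basic sets.\<close>

lemma mtopology_uI_dist:
  assumes I: "ideal I (cont_ring X)"
  shows "Metric_space.mtopology (carrier (cont_ring X)) (uI_dist X I) = uI_topology X I"
proof -
  let ?C = "carrier (cont_ring X)"
  let ?P = "\<lambda>U. \<exists>f\<in>?C. \<exists>\<epsilon>>0. U = uI_ball X I f \<epsilon>"
  interpret Metric_space ?C "uI_dist X I"
    by (rule Metric_space_uI_dist[OF I])
  have "openin mtopology U \<longleftrightarrow> openin (uI_topology X I) U" for U
  proof
    assume U: "openin mtopology U"
    have "\<exists>V. ?P V \<and> f \<in> V \<and> V \<subseteq> U" if f: "f \<in> U" for f
    proof -
      obtain r where r: "r > 0" "mball f r \<subseteq> U"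
        using U f unfolding openin_mtopology by blast
      have fC: "f \<in> ?C" using U f unfolding openin_mtopology by blast
      have b: "mball f (min r 1) = uI_ball X I f (min r 1)"
        using r fC by (intro mball_uI_dist[OF I]) auto
      have "mball f (min r 1) \<subseteq> mball f r" by (rule mball_subset_concentric) simp
      moreover have "f \<in> mball f (min r 1)" using fC r(1) by simp
      ultimately show ?thesis
        using b fC r
        by (intro exI[of _ "uI_ball X I f (min r 1)"])
          (auto intro!: bexI[of _ f] exI[of _ "min r 1"])
    qed
    then show "openin (uI_topology X I) U"
      unfolding openin_uI_topology[OF I] arbitrary_union_of_alt by blast
  next
    assume U: "openin (uI_topology X I) U"
    have "f \<in> ?C \<and> (\<exists>r>0. mball f r \<subseteq> U)" if f: "f \<in> U" for f
    proof -
      obtain g \<epsilon> where g: "g \<in> ?C" "f \<in> uI_ball X I g \<epsilon>" "uI_ball X I g \<epsilon> \<subseteq> U"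
        using U f unfolding openin_uI_topology[OF I] arbitrary_union_of_alt by blast
      \<comment> \<open>The basic set containing \<open>f\<close> may be centred elsewhere, at
        \<open>g\<close>; it is replaced by a smaller one centred at \<open>f\<close>, as a metric
        ball around \<open>f\<close> is wanted.\<close>
      obtain r where r: "r > 0" "uI_ball X I f r \<subseteq> uI_ball X I g \<epsilon>"
        using uI_ball_subset[OF I g(1,2)] by blast
      have fC: "f \<in> ?C" using g(2) by (simp add: uI_ball_def)
      have "mball f (min r 1) = uI_ball X I f (min r 1)"
        using r fC by (intro mball_uI_dist[OF I]) auto
      also have "\<dots> \<subseteq> U" using uI_ball_mono[of "min r 1" r X I f] r(2) g(3) by auto
      finally show ?thesis using fC r(1) by (intro conjI exI[of _ "min r 1"]) auto
    qed
    then show "openin mtopology U"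
      unfolding openin_mtopology by blast
  qed
  then show ?thesis by (simp add: topology_eq)
qed

theorem theorem4p1:
  fixes X :: "'a topology" and I :: "('a \<Rightarrow> real) set"
  assumes "completely_regular_space X" and "Hausdorff_space X"
    and "ideal I (cont_ring X)"
  shows "metrizable_space (uI_topology X I)
    \<and> Metric_space (carrier (cont_ring X)) (uI_dist X I)
    \<and> Metric_space.mtopology (carrier (cont_ring X)) (uI_dist X I) = uI_topology X I"
  using Metric_space_uI_dist[OF assms(3)] mtopology_uI_dist[OF assms(3)]
    Metric_space.metrizable_space_mtopology by metis

end
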